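(* For every $n\ge 1$, the generalized Lawrence-Krammer representation of the Artin group $A_{I_2(2n+1)}$ on the $F_\Lambda$-vector space $V_{I_2(2n+1)}$ (given by $\sigma_i\mapsto X_i$, $i=0,1$, with the operators in the context) is irreducible.
   Context: Notation: $F_\Lambda=\mathbb{Q}(m,l)$ with independent variables $m,l$. $A_{I_2(2n+1)}$ is the Artin group with generators $\sigma_0,\sigma_1$ and the single relation that the two alternating words of length $2n+1$ in $\sigma_0,\sigma_1$ (one beginning with $\sigma_0$, the other with $\sigma_1$) are equal. The generalized Lawrence-Krammer representation: $V_{I_2(2n+1)}$ is the $F_\Lambda$-vector space with basis $v_0,\dots,v_{2n}$, and $\sigma_0,\sigma_1$ act by the operators $X_0v_0=lv_0$; $X_0v_{2k}=mv_0-mv_{2k}+v_{2k-1}$ for $1\le k\le n$; $X_0v_{2k+1}=v_{2k+2}$ for $0\le k\le n-1$; $X_1v_{2k}=v_{2k+1}$ for $0\le k\le n-1$; $X_1v_{2n}=lv_{2n}$; $X_1v_{2k+1}=v_{2k}-mv_{2k+1}+ml\,v_{2n}$ for $0\le k\le n-1$. *)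

theory Defs
  imports
    "Jordan_Normal_Form.VS_Connect"
    "HOL-Computational_Algebra.Fraction_Field"
begin

text \<open>A letter is a pair \<open>(x, e)\<close>; it stands for the generator \<open>x\<close> if \<open>e\<close> is true and for its
  formal inverse if \<open>e\<close> is false.  All elements of the type \<^typ>\<open>'g\<close> are generators.  A pair of
  words \<open>(u, v)\<close> in the set of relations stands for the relation \<open>u = v\<close>.\<close>

type_synonym 'g word = "('g \<times> bool) list"

inductive pres_eq :: "('g word \<times> 'g word) set \<Rightarrow> 'g word \<Rightarrow> 'g word \<Rightarrow> bool"
  for R :: "('g word \<times> 'g word) set" where
  refl: "pres_eq R u u"
| sym: "pres_eq R u v \<Longrightarrow> pres_eq R v u"
| trans: "pres_eq R u v \<Longrightarrow> pres_eq R v w \<Longrightarrow> pres_eq R u w"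
| append: "pres_eq R u u' \<Longrightarrow> pres_eq R v v' \<Longrightarrow> pres_eq R (u @ v) (u' @ v')"
| cancel: "pres_eq R [(x, e), (x, \<not> e)] []"
| relation: "(u, v) \<in> R \<Longrightarrow> pres_eq R u v"

definition pres_class :: "('g word \<times> 'g word) set \<Rightarrow> 'g word \<Rightarrow> 'g word set" where
  "pres_class R u = {v. pres_eq R u v}"

definition presented_group :: "('g word \<times> 'g word) set \<Rightarrow> 'g word set monoid" where
  "presented_group R =
    \<lparr>carrier = range (pres_class R),
     mult = (\<lambda>A B. {w. \<exists>a\<in>A. \<exists>b\<in>B. pres_eq R (a @ b) w}),
     one = pres_class R []\<rparr>"

lemma pres_class_eq_iff: "pres_class R u = pres_class R v \<longleftrightarrow> pres_eq R u v"
  unfolding pres_class_def by (blast intro: pres_eq.refl pres_eq.sym pres_eq.trans)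

lemma pres_class_mult:
  "pres_class R u \<otimes>\<^bsub>presented_group R\<^esub> pres_class R v = pres_class R (u @ v)"
  unfolding pres_class_def presented_group_def
  by (auto intro: pres_eq.refl pres_eq.sym pres_eq.trans pres_eq.append)

lemma pres_eq_inverse:
  "pres_eq R (rev (map (\<lambda>(x, e). (x, \<not> e)) u) @ u) []"
proof (induction u)
  case Nil
  then show ?case by (simp add: pres_eq.refl)
next
  case (Cons a u)
  obtain x e where a: "a = (x, e)" by (cases a)
  let ?i = "rev (map (\<lambda>(x, e). (x, \<not> e)) u)"
  have "pres_eq R [(x, \<not> e), (x, e)] []"
    using pres_eq.cancel[of R x "\<not> e"] by simp
  then have "pres_eq R (?i @ [(x, \<not> e), (x, e)] @ u) (?i @ [] @ u)"
    by (intro pres_eq.append pres_eq.refl)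
  then show ?case
    using Cons.IH a by (auto intro: pres_eq.trans)
qed

lemma group_presented_group: "group (presented_group R)"
proof (rule groupI)
  show "\<exists>y\<in>carrier (presented_group R). y \<otimes>\<^bsub>presented_group R\<^esub> x = \<one>\<^bsub>presented_group R\<^esub>"
    if "x \<in> carrier (presented_group R)" for x
  proof -
    from that obtain u where x: "x = pres_class R u"
      by (auto simp: presented_group_def)
    have "pres_class R (rev (map (\<lambda>(x, e). (x, \<not> e)) u)) \<otimes>\<^bsub>presented_group R\<^esub> x
        = pres_class R []"
      unfolding x pres_class_mult pres_class_eq_iff by (rule pres_eq_inverse)
    then show ?thesis by (auto simp: presented_group_def)
  qed
next
  fix x y z
  assume "x \<in> carrier (presented_group R)" "y \<in> carrier (presented_group R)"
    "z \<in> carrier (presented_group R)"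
  then obtain u v w where "x = pres_class R u" "y = pres_class R v" "z = pres_class R w"
    by (auto simp: presented_group_def)
  then show "x \<otimes>\<^bsub>presented_group R\<^esub> y \<otimes>\<^bsub>presented_group R\<^esub> z
      = x \<otimes>\<^bsub>presented_group R\<^esub> (y \<otimes>\<^bsub>presented_group R\<^esub> z)"
    by (simp add: pres_class_mult)
next
  fix x y
  assume "x \<in> carrier (presented_group R)" "y \<in> carrier (presented_group R)"
  then obtain u v where "x = pres_class R u" "y = pres_class R v"
    by (auto simp: presented_group_def)
  then show "x \<otimes>\<^bsub>presented_group R\<^esub> y \<in> carrier (presented_group R)"
    by (simp add: pres_class_mult) (simp add: presented_group_def)
next
  show "\<one>\<^bsub>presented_group R\<^esub> \<in> carrier (presented_group R)"
    by (simp add: presented_group_def)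
next
  fix x
  assume "x \<in> carrier (presented_group R)"
  then obtain u where "x = pres_class R u"
    by (auto simp: presented_group_def)
  moreover have "\<one>\<^bsub>presented_group R\<^esub> = pres_class R []"
    by (simp add: presented_group_def)
  ultimately show "\<one>\<^bsub>presented_group R\<^esub> \<otimes>\<^bsub>presented_group R\<^esub> x = x"
    by (simp add: pres_class_mult)
qed

datatype artin_gen = Sigma0 | Sigma1

fun alt_word :: "'g \<Rightarrow> 'g \<Rightarrow> nat \<Rightarrow> 'g word" where
  "alt_word a b 0 = []"
| "alt_word a b (Suc k) = (a, True) # alt_word b a k"

definition artin_relations :: "nat \<Rightarrow> (artin_gen word \<times> artin_gen word) set" where
  "artin_relations k = {(alt_word Sigma0 Sigma1 k, alt_word Sigma1 Sigma0 k)}"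

definition artin_I2 :: "nat \<Rightarrow> artin_gen word set monoid" where
  "artin_I2 k = presented_group (artin_relations k)"

definition artin_sigma :: "nat \<Rightarrow> artin_gen \<Rightarrow> artin_gen word set" where
  "artin_sigma k s = pres_class (artin_relations k) [(s, True)]"

definition GL_mat :: "'a::field itself \<Rightarrow> nat \<Rightarrow> 'a mat monoid" where
  "GL_mat ty N = units_of (ring_mat ty N ())"

definition representation :: "('g, 'r) monoid_scheme \<Rightarrow> nat \<Rightarrow> ('g \<Rightarrow> 'a::field mat) \<Rightarrow> bool" where
  "representation G N \<rho> \<longleftrightarrow> group_hom G (GL_mat TYPE('a) N) \<rho>"

definition irreducible_rep :: "('g, 'r) monoid_scheme \<Rightarrow> nat \<Rightarrow> ('g \<Rightarrow> 'a::field mat) \<Rightarrow> bool" where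
  "irreducible_rep G N \<rho> \<longleftrightarrow>
    representation G N \<rho> \<and>
    carrier_vec N \<noteq> {0\<^sub>v N :: 'a vec} \<and>
    (\<forall>W. VectorSpace.subspace class_ring W (module_vec TYPE('a) N) \<longrightarrow>
         (\<forall>g\<in>carrier G. \<forall>w\<in>W. \<rho> g *\<^sub>v w \<in> W) \<longrightarrow>
         W = {0\<^sub>v N} \<or> W = carrier_vec N)"

text \<open>The field $\mathbb{Q}(m,l)$ is the fraction field of $\mathbb{Q}[m][l]$.\<close>

type_synonym F_Lambda = "rat poly poly fract"

definition var_m :: F_Lambda where "var_m = Fract [:[:0, 1:]:] 1"

definition var_l :: F_Lambda where "var_l = Fract [:0, 1:] 1"

text \<open>The basis vector $v_j$ is \<open>unit_vec (2 * n + 1) j\<close>; the function \<open>LK_X0_image n\<close> maps \<open>j\<close> to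
  $X_0 v_j$, which is column \<open>j\<close> of the matrix \<open>LK_X0 n\<close>.  Likewise for $X_1$.\<close>

definition LK_X0_image :: "nat \<Rightarrow> nat \<Rightarrow> F_Lambda vec" where
  "LK_X0_image n j =
    (let v = unit_vec (2 * n + 1) in
     if j = 0 then var_l \<cdot>\<^sub>v v 0
     else if even j then var_m \<cdot>\<^sub>v v 0 - var_m \<cdot>\<^sub>v v j + v (j - 1)
     else v (j + 1))"

definition LK_X1_image :: "nat \<Rightarrow> nat \<Rightarrow> F_Lambda vec" where
  "LK_X1_image n j =
    (let v = unit_vec (2 * n + 1) in
     if j = 2 * n then var_l \<cdot>\<^sub>v v (2 * n)
     else if even j then v (j + 1)
     else v (j - 1) - var_m \<cdot>\<^sub>v v j + (var_m * var_l) \<cdot>\<^sub>v v (2 * n))"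

definition LK_X0 :: "nat \<Rightarrow> F_Lambda mat" where
  "LK_X0 n = mat_of_cols (2 * n + 1) (map (LK_X0_image n) [0..<2 * n + 1])"

definition LK_X1 :: "nat \<Rightarrow> F_Lambda mat" where
  "LK_X1 n = mat_of_cols (2 * n + 1) (map (LK_X1_image n) [0..<2 * n + 1])"

definition is_LK_rep :: "nat \<Rightarrow> (artin_gen word set \<Rightarrow> F_Lambda mat) \<Rightarrow> bool" where
  "is_LK_rep n \<rho> \<longleftrightarrow>
    representation (artin_I2 (2 * n + 1)) (2 * n + 1) \<rho> \<and>
    \<rho> (artin_sigma (2 * n + 1) Sigma0) = LK_X0 n \<and>
    \<rho> (artin_sigma (2 * n + 1) Sigma1) = LK_X1 n"

end

theory Submission
  imports Defs
begin

text \<open>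
  Write $v_j$ for the basis vectors and $E_i = X_i^2 + m X_i - 1$ (\<open>hecke_defect\<close>).

  Existence. A homomorphism out of a presented group is the same as a choice of images that
  satisfies the relations (\<open>presented_group_universal\<close>), so invertibility of $X_0,
  X_1$ and the braid relation have to be shown. The braid relation is not checked by multiplying
  the two words out. Instead, both are identified with an explicit matrix $D$
  (\<open>garside\<close>), which represents the Garside element, the half twist of the Artin
  group. Its columns are dictated by what the half twist must do: conjugation by it exchanges the
  two generators, and it maps $v_0$ to $l v_{2n}$; as $v_j$ arises from $v_0$ by applying $X_1,
  X_0, X_1, \dots$ in turn, $D v_j$ must arise from $l v_{2n}$ by applying $X_0, X_1, X_0, \dots$,
  and these vectors have a simple closed form. From it, $D X_0 = X_1 D$ and $D X_1 = X_0 D$ follow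
  by a short calculation. If $P$ is the alternating product that starts and ends with $X_0$, then
  the vectors on which $P$ and $D$ agree form a subspace that contains $v_0$ and is stable under
  $X_1 X_0$, and this forces it to be everything (\<open>alt_prod_eq_garside\<close>). The other
  alternating product is then $D$ as well.

  Irreducibility. The vector $v_0$ is cyclic. The operator $E_0$ takes its values in the line of
  $v_0$ and $E_1$ in the line of $v_{2n}$, a vector that $D$ maps to $l v_0$. So an invariant
  subspace $W$ on which $E_0$ or $E_1$ is not zero is the whole space. If both vanish on $W$, then
  $W$ is a module over a Hecke algebra, whose relations $X_i^2 + m X_i = 1$ do not involve $l$;
  the square of the half twist should then have eigenvalues that are algebraic over
  $\mathbb{Q}(m)$, whereas it acts as the scalar $l^2$ (\<open>garside_garside\<close>), because
  it is central and $v_0$ is cyclic. The contradiction is made elementary by looking at degrees in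
  $l$: on a vector killed by $E_i$, the operator $X_i$ does not raise the largest degree of the
  coordinates (\<open>LK_X0_deg_nonpos\<close>, \<open>LK_X1_deg_nonpos\<close>), so on $W$
  neither does $D^2$; but multiplication by $l^2$ raises the degree of every nonzero vector.
\<close>

section \<open>Representations of a presented group\<close>

fun word_value :: "('a, 'b) monoid_scheme \<Rightarrow> ('g \<Rightarrow> 'a) \<Rightarrow> 'g word \<Rightarrow> 'a" where
  "word_value H f [] = \<one>\<^bsub>H\<^esub>"
| "word_value H f ((x, e) # u) = (if e then f x else inv\<^bsub>H\<^esub> f x) \<otimes>\<^bsub>H\<^esub> word_value H f u"

context group
begin

lemma word_value_closed:
  assumes "\<And>x. f x \<in> carrier G"
  shows "word_value G f u \<in> carrier G"
proof (induction u)
  case (Cons a u)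
  then show ?case using assms by (cases a) auto
qed simp

lemma word_value_append:
  assumes f: "\<And>x. f x \<in> carrier G"
  shows "word_value G f (u @ v) = word_value G f u \<otimes> word_value G f v"
proof (induction u)
  case Nil
  then show ?case by (simp add: word_value_closed f)
next
  case (Cons a u)
  then show ?case by (cases a) (simp add: m_assoc word_value_closed f)
qed

lemma word_value_pres_eq:
  assumes f: "\<And>x. f x \<in> carrier G"
    and R: "\<And>u v. (u, v) \<in> R \<Longrightarrow> word_value G f u = word_value G f v"
    and "pres_eq R u v"
  shows "word_value G f u = word_value G f v"
  using \<open>pres_eq R u v\<close>
  by induction (simp_all add: word_value_append f R)

text \<open>The universal property of a presentation (von Dyck's theorem). The value of a word is
  constant on the classes of \<^const>\<open>pres_eq\<close>, so the homomorphism can evaluate an arbitrary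
  representative of a class.\<close>

lemma presented_group_universal:
  assumes f: "\<And>x. f x \<in> carrier G"
    and R: "\<And>u v. (u, v) \<in> R \<Longrightarrow> word_value G f u = word_value G f v"
  shows "\<exists>h. group_hom (presented_group R) G h \<and> (\<forall>u. h (pres_class R u) = word_value G f u)"
proof -
  define h where "h A = word_value G f (SOME u. A = pres_class R u)" for A
  have h: "h (pres_class R u) = word_value G f u" for u
  proof -
    have "pres_class R u = pres_class R (SOME v. pres_class R u = pres_class R v)"
      by (rule someI) (rule HOL.refl)
    then show ?thesis
      unfolding h_def pres_class_eq_iff by (metis word_value_pres_eq[OF f R])
  qed
  have "h \<in> hom (presented_group R) G"
  proof (rule homI)
    fix x assume "x \<in> carrier (presented_group R)"
    then show "h x \<in> carrier G"
      by (auto simp: presented_group_def h word_value_closed f)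
  next
    fix x y assume "x \<in> carrier (presented_group R)" "y \<in> carrier (presented_group R)"
    then obtain u v where "x = pres_class R u" "y = pres_class R v"
      by (auto simp: presented_group_def)
    then show "h (x \<otimes>\<^bsub>presented_group R\<^esub> y) = h x \<otimes> h y"
      by (simp add: pres_class_mult h word_value_append f)
  qed
  then have "group_hom (presented_group R) G h"
    by (simp add: group_hom_def group_hom_axioms_def group_presented_group is_group)
  with h show ?thesis by blast
qed

end

section \<open>Fractions of nonpositive degree in $l$\<close>

text \<open>The valuation ring of the place at infinity of the rational function field: for
  \<^typ>\<open>F_Lambda\<close> it consists of the elements whose degree in $l$ is at most $0$. The
  argument only compares degrees, and membership of a quotient in this ring does that.\<close>

definition deg_nonpos :: "'a::idom poly fract set" where
  "deg_nonpos = {Fract a b | a b. b \<noteq> 0 \<and> degree a \<le> degree b}"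

text \<open>The difference of the degrees of numerator and denominator does not depend on the chosen
  fraction, so membership can be tested on any representative.\<close>

lemma Fract_in_deg_nonpos_iff:
  assumes "b \<noteq> 0"
  shows "Fract a b \<in> deg_nonpos \<longleftrightarrow> degree a \<le> degree b"
proof
  assume "Fract a b \<in> deg_nonpos"
  then obtain c d where cd: "Fract a b = Fract c d" "d \<noteq> 0" "degree c \<le> degree d"
    by (auto simp: deg_nonpos_def)
  then have eq: "a * d = c * b"
    using assms by (simp add: eq_fract)
  show "degree a \<le> degree b"
  proof (cases "a = 0")
    case False
    then have "c \<noteq> 0" using eq cd by auto
    then have "degree a + degree d = degree c + degree b"
      using arg_cong[OF eq, of degree] False assms cd by (simp add: degree_mult_eq)
    then show ?thesis using cd by simp
  qed simp
qed (use assms in \<open>auto simp: deg_nonpos_def\<close>)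

lemma deg_nonpos_mult:
  assumes "x \<in> deg_nonpos" "y \<in> deg_nonpos"
  shows "x * y \<in> deg_nonpos"
proof -
  obtain a b c d where x: "x = Fract a b" "b \<noteq> 0" "degree a \<le> degree b"
    and y: "y = Fract c d" "d \<noteq> 0" "degree c \<le> degree d"
    using assms unfolding deg_nonpos_def by blast
  have "degree (a * c) \<le> degree a + degree c" by (rule degree_mult_le)
  also have "\<dots> \<le> degree (b * d)" using x y by (simp add: degree_mult_eq)
  finally show ?thesis using x y by (simp add: Fract_in_deg_nonpos_iff)
qed

lemma deg_nonpos_add:
  assumes "x \<in> deg_nonpos" "y \<in> deg_nonpos"
  shows "x + y \<in> deg_nonpos"
proof -
  obtain a b c d where x: "x = Fract a b" "b \<noteq> 0" "degree a \<le> degree b"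
    and y: "y = Fract c d" "d \<noteq> 0" "degree c \<le> degree d"
    using assms unfolding deg_nonpos_def by blast
  have "degree (a * d + c * b) \<le> degree (b * d)"
    using x y degree_mult_le[of a d] degree_mult_le[of c b]
    by (intro degree_add_le) (simp_all add: degree_mult_eq)
  then show ?thesis using x y by (simp add: Fract_in_deg_nonpos_iff)
qed

lemma deg_nonpos_0: "0 \<in> deg_nonpos"
  and deg_nonpos_1: "1 \<in> deg_nonpos"
  by (simp_all add: Zero_fract_def One_fract_def Fract_in_deg_nonpos_iff)

lemma deg_nonpos_uminus: "x \<in> deg_nonpos \<Longrightarrow> - x \<in> deg_nonpos"
  by (cases x) (simp add: Fract_in_deg_nonpos_iff)

lemma deg_nonpos_diff: "x \<in> deg_nonpos \<Longrightarrow> y \<in> deg_nonpos \<Longrightarrow> x - y \<in> deg_nonpos"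
  using deg_nonpos_add[of x "- y"] deg_nonpos_uminus[of y] by simp

lemma deg_nonpos_sum: "(\<And>i. i \<in> S \<Longrightarrow> f i \<in> deg_nonpos) \<Longrightarrow> sum f S \<in> deg_nonpos"
  by (induction S rule: infinite_finite_induct) (auto simp: deg_nonpos_0 deg_nonpos_add)

lemma deg_nonpos_or_inverse: "x \<in> deg_nonpos \<or> inverse x \<in> deg_nonpos"
proof (cases x)
  case (Fract a b)
  then show ?thesis
    by (cases "a = 0") (auto simp: Fract_in_deg_nonpos_iff rat_number_collapse deg_nonpos_0)
qed

text \<open>Any two elements are comparable with respect to divisibility in a valuation ring, so a
  finite family that is not zero has a member of largest degree. Dividing by it brings all members
  of the family into the ring and makes one of them equal to $1$.\<close>

lemma max_degree_index:
  assumes "finite S" "s \<in> S" "x s \<noteq> 0"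
  obtains i where "i \<in> S" "x i \<noteq> 0" "\<forall>j\<in>S. x j / x i \<in> deg_nonpos"
proof -
  have "\<exists>i\<in>S. x i \<noteq> 0 \<and> (\<forall>j\<in>S. x j / x i \<in> deg_nonpos)" if "\<exists>s\<in>S. x s \<noteq> 0"
    using \<open>finite S\<close> that
  proof (induction S)
    case (insert k S)
    show ?case
    proof (cases "\<exists>s\<in>S. x s \<noteq> 0")
      case True
      then obtain i where i: "i \<in> S" "x i \<noteq> 0" "\<forall>j\<in>S. x j / x i \<in> deg_nonpos"
        using insert.IH by blast
      show ?thesis
      proof (cases "x k / x i \<in> deg_nonpos")
        case True
        with i show ?thesis by auto
      next
        case False
        then have nz: "x k \<noteq> 0" by (auto simp: deg_nonpos_0)
        have ki: "x i / x k \<in> deg_nonpos"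
          using deg_nonpos_or_inverse[of "x k / x i"] False by simp
        have "x j / x k \<in> deg_nonpos" if "j \<in> S" for j
          using deg_nonpos_mult[OF i(3)[rule_format, OF that] ki] i(2) by simp
        with nz show ?thesis by (auto simp: deg_nonpos_1)
      qed
    next
      case False
      with insert.prems have "x k \<noteq> 0" by auto
      with False show ?thesis by (auto simp: deg_nonpos_0 deg_nonpos_1)
    qed
  qed simp
  with assms that show thesis by blast
qed

lemma var_m_deg_nonpos: "var_m \<in> deg_nonpos"
  by (simp add: var_m_def Fract_in_deg_nonpos_iff)

lemma var_l_sq_not_deg_nonpos: "var_l * var_l \<notin> deg_nonpos"
  by (simp add: var_l_def Fract_in_deg_nonpos_iff)

lemma var_l_nonzero: "var_l \<noteq> 0"
  using var_l_sq_not_deg_nonpos by (auto simp: deg_nonpos_0)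

lemma var_l_plus_var_m: "var_l + var_m = Fract [:[:0, 1:], 1:] 1"
  by (simp add: var_l_def var_m_def)

lemma var_l_plus_var_m_nonzero: "var_l + var_m \<noteq> 0"
  by (simp add: var_l_plus_var_m Zero_fract_def eq_fract)

lemma deg_nonpos_inverse_l_plus_m: "1 / (var_l + var_m) \<in> deg_nonpos"
  by (simp add: var_l_plus_var_m One_fract_def Fract_in_deg_nonpos_iff)

lemma deg_nonpos_l_over_l_plus_m: "var_l / (var_l + var_m) \<in> deg_nonpos"
  unfolding var_l_plus_var_m by (simp add: var_l_def Fract_in_deg_nonpos_iff)

section \<open>The matrices $X_0$ and $X_1$ in coordinates\<close>

abbreviation bvec :: "nat \<Rightarrow> nat \<Rightarrow> F_Lambda vec" where
  "bvec n \<equiv> unit_vec (Suc (2 * n))"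

text \<open>Indices of basis vectors are kept in the form \<open>2 * k\<close>, \<open>Suc (2 * k)\<close> or
  \<open>Suc (Suc (2 * k))\<close>, which the simplifier leaves unchanged; these rules separate them by
  parity.\<close>

lemma Suc_double_neq_double [simp]: "Suc (2 * a) \<noteq> 2 * b" "2 * b \<noteq> Suc (2 * a)"
  "Suc (Suc (Suc (2 * a))) \<noteq> 2 * b" "2 * b \<noteq> Suc (Suc (Suc (2 * a)))" for a b :: nat
  by presburger+

lemma LK_X0_carrier [simp]: "LK_X0 n \<in> carrier_mat (Suc (2 * n)) (Suc (2 * n))"
  and LK_X1_carrier [simp]: "LK_X1 n \<in> carrier_mat (Suc (2 * n)) (Suc (2 * n))"
  by (simp_all add: LK_X0_def LK_X1_def mat_of_cols_def)

lemma mat_mult_unit_vec: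
  fixes A :: "'a::comm_semiring_1 mat"
  assumes "A \<in> carrier_mat N N" "j < N"
  shows "A *\<^sub>v unit_vec N j = col A j"
  using assms by (intro eq_vecI) auto

lemma LK_image_carrier: "LK_X0_image n j \<in> carrier_vec (Suc (2 * n))"
  "LK_X1_image n j \<in> carrier_vec (Suc (2 * n))"
  by (auto simp: LK_X0_image_def LK_X1_image_def Let_def)

lemma LK_X0_bvec: "j < Suc (2 * n) \<Longrightarrow> LK_X0 n *\<^sub>v bvec n j = LK_X0_image n j"
  and LK_X1_bvec: "j < Suc (2 * n) \<Longrightarrow> LK_X1 n *\<^sub>v bvec n j = LK_X1_image n j"
  by (simp_all only: mat_mult_unit_vec[OF LK_X0_carrier] mat_mult_unit_vec[OF LK_X1_carrier])
     (simp_all add: LK_X0_def LK_X1_def LK_image_carrier del: upt_Suc)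

lemma LK_X0_bvec_0: "LK_X0 n *\<^sub>v bvec n 0 = var_l \<cdot>\<^sub>v bvec n 0"
  and LK_X0_bvec_odd: "k < n \<Longrightarrow> LK_X0 n *\<^sub>v bvec n (Suc (2 * k)) = bvec n (Suc (Suc (2 * k)))"
  and LK_X0_bvec_even: "k < n \<Longrightarrow> LK_X0 n *\<^sub>v bvec n (Suc (Suc (2 * k))) =
    var_m \<cdot>\<^sub>v bvec n 0 - var_m \<cdot>\<^sub>v bvec n (Suc (Suc (2 * k))) + bvec n (Suc (2 * k))"
  by (simp_all add: LK_X0_bvec LK_X0_image_def Let_def)

lemma LK_X1_bvec_last: "LK_X1 n *\<^sub>v bvec n (2 * n) = var_l \<cdot>\<^sub>v bvec n (2 * n)"
  and LK_X1_bvec_even: "k < n \<Longrightarrow> LK_X1 n *\<^sub>v bvec n (2 * k) = bvec n (Suc (2 * k))"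
  and LK_X1_bvec_odd: "k < n \<Longrightarrow> LK_X1 n *\<^sub>v bvec n (Suc (2 * k)) =
    bvec n (2 * k) - var_m \<cdot>\<^sub>v bvec n (Suc (2 * k)) + (var_m * var_l) \<cdot>\<^sub>v bvec n (2 * n)"
  by (simp_all add: LK_X1_bvec LK_X1_image_def Let_def)

lemma mat_mult_vec_index_sum:
  assumes "A \<in> carrier_mat N N" "w \<in> carrier_vec N" "i < N"
  shows "(A *\<^sub>v w) $ i = (\<Sum>j<N. A $$ (i, j) * w $ j)"
  using assms by (auto simp: scalar_prod_def atLeast0LessThan intro!: sum.cong)

lemma LK_X0_index: "i < Suc (2 * n) \<Longrightarrow> j < Suc (2 * n) \<Longrightarrow> LK_X0 n $$ (i, j) = LK_X0_image n j $ i"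
  and LK_X1_index: "i < Suc (2 * n) \<Longrightarrow> j < Suc (2 * n) \<Longrightarrow> LK_X1 n $$ (i, j) = LK_X1_image n j $ i"
  by (simp_all add: LK_X0_def LK_X1_def mat_of_cols_index del: upt_Suc)

lemma basis_index_cases:
  assumes "j < Suc (2 * n)"
  obtains (zero) "j = 0"
    | (odd) k where "k < n" "j = Suc (2 * k)"
    | (even) k where "k < n" "j = Suc (Suc (2 * k))"
proof (cases "even j")
  case True
  then obtain b where "j = 2 * b" by blast
  with assms zero even[of "b - 1"] show thesis by (cases b) auto
next
  case False
  then obtain b where "j = Suc (2 * b)" by (auto elim: oddE)
  with assms odd[of b] show thesis by auto
qed

text \<open>Only the coordinate $0$ of $X_0 w$ involves $l$; on the other coordinates $X_0$ acts in
  blocks of size two. The same holds for $X_1$ with the coordinate $2n$. This is the reason for the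
  shape of $E_0$ and $E_1$ and for the degree estimates below.\<close>

lemma LK_X0_mult_index_odd:
  assumes w: "w \<in> carrier_vec (Suc (2 * n))" and k: "k < n"
  shows "(LK_X0 n *\<^sub>v w) $ Suc (2 * k) = w $ Suc (Suc (2 * k))"
proof -
  have i: "Suc (2 * k) < Suc (2 * n)" using k by simp
  have entry: "LK_X0 n $$ (Suc (2 * k), j) * w $ j = (if j = Suc (Suc (2 * k)) then w $ j else 0)"
    if "j \<in> {..<Suc (2 * n)}" for j
    using that[unfolded lessThan_iff] k
    by (cases rule: basis_index_cases) (auto simp: LK_X0_index LK_X0_image_def Let_def)
  have "(LK_X0 n *\<^sub>v w) $ (Suc (2 * k)) =
      (\<Sum>j<Suc (2 * n). (if j = Suc (Suc (2 * k)) then w $ j else 0))"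
    unfolding mat_mult_vec_index_sum[OF LK_X0_carrier w i] by (rule sum.cong[OF HOL.refl entry])
  then show ?thesis
    using i by (simp add: sum_subtractf del: sum.lessThan_Suc)
qed

lemma LK_X0_mult_index_even:
  assumes w: "w \<in> carrier_vec (Suc (2 * n))" and k: "k < n"
  shows "(LK_X0 n *\<^sub>v w) $ Suc (Suc (2 * k)) = w $ Suc (2 * k) - var_m * w $ Suc (Suc (2 * k))"
proof -
  have i: "Suc (Suc (2 * k)) < Suc (2 * n)" using k by simp
  have entry: "LK_X0 n $$ (Suc (Suc (2 * k)), j) * w $ j =
      (if j = Suc (2 * k) then w $ j else 0) - (if j = Suc (Suc (2 * k)) then var_m * w $ j else 0)"
    if "j \<in> {..<Suc (2 * n)}" for j
    using that[unfolded lessThan_iff] k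
    by (cases rule: basis_index_cases) (auto simp: LK_X0_index LK_X0_image_def Let_def)
  have "(LK_X0 n *\<^sub>v w) $ (Suc (Suc (2 * k))) =
      (\<Sum>j<Suc (2 * n). (if j = Suc (2 * k) then w $ j else 0)
        - (if j = Suc (Suc (2 * k)) then var_m * w $ j else 0))"
    unfolding mat_mult_vec_index_sum[OF LK_X0_carrier w i] by (rule sum.cong[OF HOL.refl entry])
  then show ?thesis
    using i by (simp add: sum_subtractf del: sum.lessThan_Suc)
qed

lemma LK_X0_mult_index_first:
  assumes w: "w \<in> carrier_vec (Suc (2 * n))"
  shows "(LK_X0 n *\<^sub>v w) $ 0 =
    var_l * w $ 0 + (\<Sum>j=1..2 * n. if even j then var_m * w $ j else 0)"
proof -
  have "LK_X0 n $$ (0, j) * w $ j =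
      (if j = 0 then var_l * w $ j else 0) + (if j \<noteq> 0 \<and> even j then var_m * w $ j else 0)"
    if "j \<in> {..<Suc (2 * n)}" for j
    using that[unfolded lessThan_iff]
    by (cases rule: basis_index_cases) (auto simp: LK_X0_index LK_X0_image_def Let_def)
  moreover have "{..<Suc (2 * n)} = insert 0 {1..2 * n}" by auto
  ultimately show ?thesis
    using w by (subst mat_mult_vec_index_sum)
      (auto simp del: sum.lessThan_Suc intro!: sum.cong)
qed

lemma LK_X1_mult_index_even:
  assumes w: "w \<in> carrier_vec (Suc (2 * n))" and k: "k < n"
  shows "(LK_X1 n *\<^sub>v w) $ (2 * k) = w $ Suc (2 * k)"
proof -
  have i: "2 * k < Suc (2 * n)" using k by simp
  have entry: "LK_X1 n $$ (2 * k, j) * w $ j = (if j = Suc (2 * k) then w $ j else 0)"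
    if "j \<in> {..<Suc (2 * n)}" for j
    using that[unfolded lessThan_iff] k
    by (cases rule: basis_index_cases) (auto simp: LK_X1_index LK_X1_image_def Let_def)
  have "(LK_X1 n *\<^sub>v w) $ (2 * k) =
      (\<Sum>j<Suc (2 * n). (if j = Suc (2 * k) then w $ j else 0))"
    unfolding mat_mult_vec_index_sum[OF LK_X1_carrier w i] by (rule sum.cong[OF HOL.refl entry])
  then show ?thesis
    using k by (simp add: sum_subtractf del: sum.lessThan_Suc)
qed

lemma LK_X1_mult_index_odd:
  assumes w: "w \<in> carrier_vec (Suc (2 * n))" and k: "k < n"
  shows "(LK_X1 n *\<^sub>v w) $ Suc (2 * k) = w $ (2 * k) - var_m * w $ Suc (2 * k)"
proof -
  have i: "Suc (2 * k) < Suc (2 * n)" using k by simp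
  have entry: "LK_X1 n $$ (Suc (2 * k), j) * w $ j =
      (if j = 2 * k then w $ j else 0) - (if j = Suc (2 * k) then var_m * w $ j else 0)"
    if "j \<in> {..<Suc (2 * n)}" for j
    using that[unfolded lessThan_iff] k
    by (cases rule: basis_index_cases) (auto simp: LK_X1_index LK_X1_image_def Let_def)
  have "(LK_X1 n *\<^sub>v w) $ (Suc (2 * k)) =
      (\<Sum>j<Suc (2 * n). (if j = 2 * k then w $ j else 0)
        - (if j = Suc (2 * k) then var_m * w $ j else 0))"
    unfolding mat_mult_vec_index_sum[OF LK_X1_carrier w i] by (rule sum.cong[OF HOL.refl entry])
  then show ?thesis
    using i by (simp add: sum_subtractf del: sum.lessThan_Suc)
qed

lemma LK_X1_mult_index_last:
  assumes w: "w \<in> carrier_vec (Suc (2 * n))"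
  shows "(LK_X1 n *\<^sub>v w) $ (2 * n) =
    var_l * w $ (2 * n) + (\<Sum>j<2 * n. if odd j then var_m * var_l * w $ j else 0)"
proof -
  have "LK_X1 n $$ (2 * n, j) * w $ j =
      (if j = 2 * n then var_l * w $ j else 0) + (if odd j then var_m * var_l * w $ j else 0)"
    if "j \<in> {..<Suc (2 * n)}" for j
    using that[unfolded lessThan_iff]
    by (cases rule: basis_index_cases) (auto simp: LK_X1_index LK_X1_image_def Let_def)
  then have "(LK_X1 n *\<^sub>v w) $ (2 * n) = (\<Sum>j<Suc (2 * n).
      (if j = 2 * n then var_l * w $ j else 0) + (if odd j then var_m * var_l * w $ j else 0))"
    unfolding mat_mult_vec_index_sum[OF LK_X1_carrier w lessI] by (rule sum.cong[OF HOL.refl])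
  then show ?thesis by (simp add: sum.distrib)
qed

section \<open>The Garside matrix\<close>

text \<open>The vector $\sum_{i \le k} (v_{2i} - v_{2n-2i})$, given by coordinates. Its companion below is
  $\sum_{i < k} (v_{2i+1} - v_{2n-1-2i})$. With explicit coordinates it is immediate that the latter
  vanishes for $k = n$, where the summands cancel in pairs.\<close>

definition even_part :: "nat \<Rightarrow> nat \<Rightarrow> F_Lambda vec" where
  "even_part n k = vec (2 * n + 1) (\<lambda>i. if even i
     then (if i \<le> 2 * k then 1 else 0) - (if 2 * n \<le> i + 2 * k then 1 else 0) else 0)"

definition odd_part :: "nat \<Rightarrow> nat \<Rightarrow> F_Lambda vec" where
  "odd_part n k = vec (2 * n + 1) (\<lambda>i. if odd i
     then (if i < 2 * k then 1 else 0) - (if 2 * n < i + 2 * k then 1 else 0) else 0)"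

lemma parts_carrier [simp]: "even_part n k \<in> carrier_vec (Suc (2 * n))"
  "odd_part n k \<in> carrier_vec (Suc (2 * n))"
  by (simp_all add: even_part_def odd_part_def)

lemma even_part_0: "even_part n 0 = bvec n 0 - bvec n (2 * n)"
  by (rule eq_vecI) (auto simp: even_part_def)

lemma odd_part_0: "odd_part n 0 = 0\<^sub>v (Suc (2 * n))"
  by (rule eq_vecI) (auto simp: odd_part_def less_Suc_eq)

lemma odd_part_n: "odd_part n n = 0\<^sub>v (Suc (2 * n))"
  by (rule eq_vecI) (auto simp: odd_part_def less_Suc_eq)

lemma even_part_Suc:
  assumes "k < n"
  shows "even_part n (Suc k) = even_part n k + bvec n (Suc (Suc (2 * k))) - bvec n (2 * (n - Suc k))"
proof -
  obtain p where n: "n = Suc (k + p)" using less_imp_Suc_add[OF assms] by blast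
  show ?thesis
  proof (rule eq_vecI)
    fix i assume "i < dim_vec (even_part n k + bvec n (Suc (Suc (2 * k))) - bvec n (2 * (n - Suc k)))"
    then have "i < Suc (2 * n)" by simp
    then show "even_part n (Suc k) $ i =
        (even_part n k + bvec n (Suc (Suc (2 * k))) - bvec n (2 * (n - Suc k))) $ i"
      unfolding n by (cases "even i") (auto simp: even_part_def elim!: evenE oddE)
  qed (simp add: even_part_def)
qed

lemma odd_part_Suc:
  assumes "k < n"
  shows "odd_part n (Suc k) = odd_part n k + bvec n (Suc (2 * k)) - bvec n (Suc (2 * (n - Suc k)))"
proof -
  obtain p where n: "n = Suc (k + p)" using less_imp_Suc_add[OF assms] by blast
  show ?thesis
  proof (rule eq_vecI)
    fix i assume "i < dim_vec (odd_part n k + bvec n (Suc (2 * k)) - bvec n (Suc (2 * (n - Suc k))))"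
    then have "i < Suc (2 * n)" by simp
    then show "odd_part n (Suc k) $ i =
        (odd_part n k + bvec n (Suc (2 * k)) - bvec n (Suc (2 * (n - Suc k)))) $ i"
      unfolding n by (cases "even i") (auto simp: odd_part_def elim!: evenE oddE, presburger?)
  qed (simp add: odd_part_def)
qed

lemma mat_eq_on_basis:
  fixes A B :: "'a::comm_semiring_1 mat"
  assumes A: "A \<in> carrier_mat N N" and B: "B \<in> carrier_mat N N"
    and eq: "\<And>j. j < N \<Longrightarrow> A *\<^sub>v unit_vec N j = B *\<^sub>v unit_vec N j"
  shows "A = B"
  using A B eq by (intro mat_col_eqI) (auto simp: mat_mult_unit_vec[OF A] mat_mult_unit_vec[OF B])

lemma mult_square_carrier [simp]:
  "A \<in> carrier_mat N N \<Longrightarrow> B \<in> carrier_mat N N \<Longrightarrow> A * B \<in> carrier_mat N N"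
  by (rule mult_carrier_mat)

lemma mat_mult_zero_vec:
  fixes A :: "'a::semiring_0 mat"
  assumes "A \<in> carrier_mat N N"
  shows "A *\<^sub>v 0\<^sub>v N = 0\<^sub>v N"
  using assms by (auto simp: scalar_prod_def)

lemma smult_vec_zero [simp]: "a \<cdot>\<^sub>v 0\<^sub>v N = (0\<^sub>v N :: 'a::mult_zero vec)"
  by (rule eq_vecI) auto

lemmas LK_linear =
  mult_add_distrib_mat_vec[OF LK_X0_carrier] mult_add_distrib_mat_vec[OF LK_X1_carrier]
  mult_minus_distrib_mat_vec[OF LK_X0_carrier] mult_minus_distrib_mat_vec[OF LK_X1_carrier]
  mult_mat_vec[OF LK_X0_carrier] mult_mat_vec[OF LK_X1_carrier]

lemma parts_dim [simp]: "dim_vec (even_part n k) = Suc (2 * n)" "dim_vec (odd_part n k) = Suc (2 * n)"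
  by (simp_all add: even_part_def odd_part_def)

text \<open>Together with the images of the basis vectors, the next four rules describe $X_0$ and $X_1$
  on the columns of the Garside matrix. The right-hand sides stay within the two families and the
  basis because the summands with index $i$ are moved to summands with a neighbouring index.\<close>

lemma LK_X0_odd_part:
  "k \<le> n \<Longrightarrow> LK_X0 n *\<^sub>v odd_part n k = even_part n k - bvec n 0 + bvec n (2 * (n - k))"
proof (induction k)
  case 0
  have "LK_X0 n *\<^sub>v 0\<^sub>v (Suc (2 * n)) = 0\<^sub>v (Suc (2 * n))"
    by (rule mat_mult_zero_vec) simp
  then show ?case
    by (simp add: odd_part_0 even_part_0) (auto simp del: index_unit_vec(1))
next
  case (Suc k)
  have e: "n - k = Suc (n - Suc k)" using Suc.prems by simp
  show ?case
    using Suc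
    unfolding odd_part_Suc[OF Suc_le_lessD[OF Suc.prems]] even_part_Suc[OF Suc_le_lessD[OF Suc.prems]]
    by (simp add: LK_linear LK_X0_bvec_odd e)
      (auto simp del: index_unit_vec(1) simp: algebra_simps)
qed

lemma LK_X1_odd_part:
  "k \<le> n \<Longrightarrow> LK_X1 n *\<^sub>v odd_part n k =
    even_part n k - bvec n (2 * k) + bvec n (2 * n) - var_m \<cdot>\<^sub>v odd_part n k"
proof (induction k)
  case 0
  have "LK_X1 n *\<^sub>v 0\<^sub>v (Suc (2 * n)) = 0\<^sub>v (Suc (2 * n))"
    by (rule mat_mult_zero_vec) simp
  then show ?case
    by (simp add: odd_part_0 even_part_0) (auto simp del: index_unit_vec(1))
next
  case (Suc k)
  show ?case
    using Suc
    unfolding odd_part_Suc[OF Suc_le_lessD[OF Suc.prems]] even_part_Suc[OF Suc_le_lessD[OF Suc.prems]]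
    by (simp add: LK_linear LK_X1_bvec_odd)
      (auto simp del: index_unit_vec(1) simp: algebra_simps)
qed

lemma LK_X1_even_part:
  "k < n \<Longrightarrow> LK_X1 n *\<^sub>v even_part n k =
    odd_part n (Suc k) + bvec n (Suc (2 * (n - Suc k))) - var_l \<cdot>\<^sub>v bvec n (2 * n)"
proof (induction k)
  case 0
  then show ?case
    using LK_X1_bvec_even[of 0 n]
    by (simp add: LK_linear odd_part_Suc even_part_0 odd_part_0 LK_X1_bvec_last)
      (auto simp del: index_unit_vec(1))
next
  case (Suc k)
  have k: "k < n" using Suc.prems by simp
  show ?case
    using Suc LK_X1_bvec_even[of "Suc k" n] LK_X1_bvec_even[of "n - Suc k" n]
    unfolding odd_part_Suc[OF Suc.prems] even_part_Suc[OF k]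
    by (simp add: LK_linear)
      (auto simp del: index_unit_vec(1) simp: algebra_simps)
qed

lemma LK_X0_even_part:
  "k < n \<Longrightarrow> LK_X0 n *\<^sub>v even_part n k =
    var_l \<cdot>\<^sub>v bvec n 0 - var_m \<cdot>\<^sub>v even_part n k + odd_part n k - bvec n (Suc (2 * (n - Suc k)))"
proof (induction k)
  case 0
  have e: "2 * n = Suc (Suc (2 * (n - Suc 0)))" using 0 by simp
  have "LK_X0 n *\<^sub>v bvec n (2 * n) = var_m \<cdot>\<^sub>v bvec n 0 - var_m \<cdot>\<^sub>v bvec n (2 * n)
      + bvec n (Suc (2 * (n - Suc 0)))"
    using LK_X0_bvec_even[of "n - Suc 0" n] 0 unfolding e[symmetric] by simp
  then show ?case
    by (simp add: LK_linear even_part_0 odd_part_0 LK_X0_bvec_0)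
      (auto simp del: index_unit_vec(1) simp: algebra_simps)
next
  case (Suc k)
  have e: "n - Suc k = Suc (n - Suc (Suc k))" using Suc.prems by simp
  have k: "k < n" using Suc.prems by simp
  show ?case
    using Suc LK_X0_bvec_even[of k n] LK_X0_bvec_even[of "n - Suc (Suc k)" n]
    unfolding odd_part_Suc[OF k] even_part_Suc[OF k]
    by (simp add: LK_linear e)
      (auto simp del: index_unit_vec(1) simp: algebra_simps)
qed

text \<open>The image of $v_j$ under the half twist: applying $j$ alternating factors $X_0, X_1, X_0, \dots$
  to $l v_{2n}$ yields $l (v_{2n-j} + m s)$, where $s$ is one of the vectors above.\<close>

definition garside_image :: "nat \<Rightarrow> nat \<Rightarrow> F_Lambda vec" where
  "garside_image n j = var_l \<cdot>\<^sub>v (bvec n (2 * n - j) +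
    var_m \<cdot>\<^sub>v (if even j then odd_part n (j div 2) else even_part n (j div 2)))"

definition garside :: "nat \<Rightarrow> F_Lambda mat" where
  "garside n = mat_of_cols (2 * n + 1) (map (garside_image n) [0..<2 * n + 1])"

lemma garside_carrier [simp]: "garside n \<in> carrier_mat (Suc (2 * n)) (Suc (2 * n))"
  by (simp add: garside_def mat_of_cols_def)

lemmas garside_linear = mult_add_distrib_mat_vec[OF garside_carrier]
  mult_minus_distrib_mat_vec[OF garside_carrier] mult_mat_vec[OF garside_carrier]

lemmas garside_LK_assoc =
  assoc_mult_mat_vec[OF garside_carrier LK_X0_carrier] assoc_mult_mat_vec[OF garside_carrier LK_X1_carrier]
  assoc_mult_mat_vec[OF LK_X0_carrier garside_carrier] assoc_mult_mat_vec[OF LK_X1_carrier garside_carrier]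

lemma garside_image_carrier: "garside_image n j \<in> carrier_vec (Suc (2 * n))"
  by (simp add: garside_image_def)

lemma garside_bvec: "j < Suc (2 * n) \<Longrightarrow> garside n *\<^sub>v bvec n j = garside_image n j"
  by (simp only: mat_mult_unit_vec[OF garside_carrier])
     (simp add: garside_def garside_image_carrier del: upt_Suc)

lemma garside_bvec_even: "k \<le> n \<Longrightarrow>
    garside n *\<^sub>v bvec n (2 * k) = var_l \<cdot>\<^sub>v (bvec n (2 * (n - k)) + var_m \<cdot>\<^sub>v odd_part n k)"
  by (simp add: garside_bvec garside_image_def diff_mult_distrib2)

lemma garside_bvec_odd: "k < n \<Longrightarrow> garside n *\<^sub>v bvec n (Suc (2 * k)) =
    var_l \<cdot>\<^sub>v (bvec n (Suc (2 * (n - Suc k))) + var_m \<cdot>\<^sub>v even_part n k)"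
proof -
  assume "k < n"
  then have "2 * n - Suc (2 * k) = Suc (2 * (n - Suc k))" by simp
  with \<open>k < n\<close> show ?thesis by (simp add: garside_bvec garside_image_def)
qed

lemma garside_bvec_0: "garside n *\<^sub>v bvec n 0 = var_l \<cdot>\<^sub>v bvec n (2 * n)"
  using garside_bvec_even[of 0 n] by (simp add: odd_part_0 smult_vec_zero)

lemma garside_bvec_last: "garside n *\<^sub>v bvec n (2 * n) = var_l \<cdot>\<^sub>v bvec n 0"
  using garside_bvec_even[of n n] by (simp add: odd_part_n smult_vec_zero)

text \<open>Conjugation by the half twist exchanges the generators. On $v_{2k}$ with $k < n$ this says that
  $X_0$ takes column $2k$ of the Garside matrix to the next one, which is how the columns were
  chosen. The computation with content is that for $v_{2k+1}$, which $X_1$ sends back to $v_{2k}$ up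
  to correction terms.\<close>

lemma garside_LK_X1: "garside n * LK_X1 n = LK_X0 n * garside n"
proof (rule mat_eq_on_basis)
  fix j assume "j < Suc (2 * n)"
  then have "j = 2 * n \<or> (\<exists>k<n. j = 2 * k) \<or> (\<exists>k<n. j = Suc (2 * k))" by presburger
  then consider "j = 2 * n" | k where "k < n" "j = 2 * k" | k where "k < n" "j = Suc (2 * k)"
    by blast
  then show "(garside n * LK_X1 n) *\<^sub>v bvec n j = (LK_X0 n * garside n) *\<^sub>v bvec n j"
  proof cases
    case 1
    then show ?thesis
      by (simp add: garside_LK_assoc LK_linear garside_linear
         LK_X1_bvec_last garside_bvec_last LK_X0_bvec_0)
  next
    case (2 k)
    have e: "n - k = Suc (n - Suc k)" using 2 by simp
    from 2 show ?thesis
      by (simp add: garside_LK_assoc LK_linear garside_linear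
         LK_X1_bvec_even garside_bvec_even garside_bvec_odd LK_X0_odd_part LK_X0_bvec_even e)
        (auto simp del: index_unit_vec(1) simp: algebra_simps)
  next
    case (3 k)
    have e: "n - k = Suc (n - Suc k)" using 3 by simp
    from 3 show ?thesis
      by (simp add: garside_LK_assoc LK_linear garside_linear
         LK_X1_bvec_odd garside_bvec_even garside_bvec_last garside_bvec_odd LK_X0_even_part LK_X0_bvec_odd e)
        (auto simp del: index_unit_vec(1) simp: algebra_simps)
  qed
qed simp_all

lemma garside_LK_X0: "garside n * LK_X0 n = LK_X1 n * garside n"
proof (rule mat_eq_on_basis)
  fix j assume "j < Suc (2 * n)"
  then show "(garside n * LK_X0 n) *\<^sub>v bvec n j = (LK_X1 n * garside n) *\<^sub>v bvec n j"
  proof (cases rule: basis_index_cases)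
    case zero
    then show ?thesis
      by (simp add: garside_LK_assoc LK_linear garside_linear
         LK_X1_bvec_last garside_bvec_0 LK_X0_bvec_0)
  next
    case (odd k)
    from odd garside_bvec_even[of "Suc k" n] show ?thesis
      by (simp add: garside_LK_assoc LK_linear garside_linear
         LK_X0_bvec_odd garside_bvec_odd LK_X1_even_part LK_X1_bvec_odd)
        (auto simp del: index_unit_vec(1) simp: algebra_simps)
  next
    case (even k)
    from even garside_bvec_even[of "Suc k" n] show ?thesis
      by (simp add: garside_LK_assoc LK_linear garside_linear
         LK_X0_bvec_even garside_bvec_0 garside_bvec_odd LK_X1_odd_part LK_X1_bvec_even even_part_Suc)
        (auto simp del: index_unit_vec(1) simp: algebra_simps)
  qed
qed simp_all

lemma unit_vecs_span:
  fixes W :: "'a::semiring_1 vec set"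
  assumes zero: "0\<^sub>v N \<in> W"
    and add: "\<And>v w. v \<in> W \<Longrightarrow> w \<in> W \<Longrightarrow> v + w \<in> W"
    and smult: "\<And>c w. w \<in> W \<Longrightarrow> c \<cdot>\<^sub>v w \<in> W"
    and unit: "\<And>j. j < N \<Longrightarrow> unit_vec N j \<in> W"
    and w: "w \<in> carrier_vec N"
  shows "w \<in> W"
proof -
  have "vec N (\<lambda>i. if i < k then w $ i else 0) \<in> W" if "k \<le> N" for k
    using that
  proof (induction k)
    case 0
    have "vec N (\<lambda>i. if i < 0 then w $ i else 0) = 0\<^sub>v N" by auto
    with zero show ?case by simp
  next
    case (Suc k)
    have "vec N (\<lambda>i. if i < Suc k then w $ i else 0) =
        vec N (\<lambda>i. if i < k then w $ i else 0) + w $ k \<cdot>\<^sub>v unit_vec N k"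
      using Suc.prems by (intro eq_vecI) (auto simp: less_Suc_eq)
    with Suc add smult unit show ?case by simp
  qed
  from this[of N] have "vec N (\<lambda>i. if i < N then w $ i else 0) \<in> W" by simp
  moreover have "vec N (\<lambda>i. if i < N then w $ i else 0) = w"
    using w by (intro eq_vecI) auto
  ultimately show ?thesis by simp
qed

text \<open>The vector $v_0$ is cyclic: $v_j$ is $X_1 v_{j-1}$ for odd $j$ and $X_0 v_{j-1}$ for even $j$.\<close>

lemma LK_cyclic:
  assumes v0: "bvec n 0 \<in> W"
    and X0: "\<And>w. w \<in> W \<Longrightarrow> LK_X0 n *\<^sub>v w \<in> W"
    and X1: "\<And>w. w \<in> W \<Longrightarrow> LK_X1 n *\<^sub>v w \<in> W"
    and "j < Suc (2 * n)"
  shows "bvec n j \<in> W"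
  using \<open>j < Suc (2 * n)\<close>
proof (induction j)
  case (Suc j)
  then have IH: "bvec n j \<in> W" by simp
  show ?case
  proof (cases "even j")
    case True
    then obtain k where "j = 2 * k" by blast
    with X1[OF IH] Suc.prems show ?thesis by (simp add: LK_X1_bvec_even)
  next
    case False
    then obtain k where "j = Suc (2 * k)" by (auto elim: oddE)
    with X0[OF IH] Suc.prems show ?thesis by (simp add: LK_X0_bvec_odd)
  qed
qed (rule v0)

lemma LK_dim_row [simp]:
  "dim_row (LK_X0 n) = Suc (2 * n)" "dim_row (LK_X1 n) = Suc (2 * n)" "dim_row (garside n) = Suc (2 * n)"
  using LK_X0_carrier[of n] LK_X1_carrier[of n] garside_carrier[of n] by (blast dest: carrier_matD)+

lemma LK_mult_vec_carrier [simp]: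
  "LK_X0 n *\<^sub>v w \<in> carrier_vec (Suc (2 * n))"
  "LK_X1 n *\<^sub>v w \<in> carrier_vec (Suc (2 * n))"
  "garside n *\<^sub>v w \<in> carrier_vec (Suc (2 * n))"
  by (auto intro: carrier_vecI)

lemma garside_LK_vec:
  assumes "w \<in> carrier_vec (Suc (2 * n))"
  shows "garside n *\<^sub>v (LK_X0 n *\<^sub>v w) = LK_X1 n *\<^sub>v (garside n *\<^sub>v w)"
    and "garside n *\<^sub>v (LK_X1 n *\<^sub>v w) = LK_X0 n *\<^sub>v (garside n *\<^sub>v w)"
  unfolding assoc_mult_mat_vec[OF garside_carrier LK_X0_carrier assms, symmetric]
    assoc_mult_mat_vec[OF garside_carrier LK_X1_carrier assms, symmetric]
    assoc_mult_mat_vec[OF LK_X0_carrier garside_carrier assms, symmetric]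
    assoc_mult_mat_vec[OF LK_X1_carrier garside_carrier assms, symmetric]
  by (simp_all only: garside_LK_X0 garside_LK_X1)

text \<open>Exchanging the generators twice is the identity, so the square of the Garside matrix
  commutes with $X_0$ and $X_1$. It multiplies the cyclic vector $v_0$ by $l^2$, hence every vector.\<close>

lemma garside_garside:
  assumes w: "w \<in> carrier_vec (Suc (2 * n))"
  shows "garside n *\<^sub>v (garside n *\<^sub>v w) = (var_l * var_l) \<cdot>\<^sub>v w"
proof -
  let ?W = "{w \<in> carrier_vec (Suc (2 * n)). garside n *\<^sub>v (garside n *\<^sub>v w) = (var_l * var_l) \<cdot>\<^sub>v w}"
  have basis: "bvec n j \<in> ?W" if "j < Suc (2 * n)" for j
  proof (rule LK_cyclic[OF _ _ _ that])
    show "bvec n 0 \<in> ?W"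
      by (simp add: garside_bvec_0 garside_bvec_last garside_linear smult_smult_assoc)
  qed (auto simp: garside_LK_vec LK_linear)
  have "w \<in> ?W"
  proof (rule unit_vecs_span[OF _ _ _ basis w])
    fix c v assume "v \<in> ?W"
    then show "c \<cdot>\<^sub>v v \<in> ?W" by (simp add: garside_linear smult_smult_assoc mult.commute[of c])
  qed (auto simp: garside_linear mat_mult_zero_vec smult_add_distrib_vec[of _ "Suc (2 * n)"])
  then show ?thesis by simp
qed

section \<open>The braid relation\<close>

text \<open>The alternating product of length \<open>2 * k + 1\<close>, which begins and ends with \<open>A\<close>. Both
  sides of the braid relation have odd length, so the recursion runs over pairs of letters.\<close>

fun alt_prod :: "'a::semiring_0 mat \<Rightarrow> 'a mat \<Rightarrow> nat \<Rightarrow> 'a mat" where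
  "alt_prod A B 0 = A"
| "alt_prod A B (Suc k) = A * (B * alt_prod A B k)"

lemma alt_prod_carrier [simp]:
  assumes "A \<in> carrier_mat N N" "B \<in> carrier_mat N N"
  shows "alt_prod A B k \<in> carrier_mat N N"
  using assms by (induction k) simp_all

lemma alt_prod_shift:
  fixes A B :: "'a::semiring_0 mat"
  assumes AB: "A \<in> carrier_mat N N" "B \<in> carrier_mat N N"
  shows "alt_prod A B k * (B * A) = (A * B) * alt_prod A B k"
proof (induction k)
  case 0
  then show ?case using AB by (simp add: assoc_mult_mat[of _ N N _ N _ N])
next
  case (Suc k)
  have "alt_prod A B (Suc k) * (B * A) = A * (B * (alt_prod A B k * (B * A)))"
    using AB by (simp add: assoc_mult_mat[of _ N N _ N _ N])
  also have "\<dots> = (A * B) * alt_prod A B (Suc k)"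
    unfolding Suc using AB by (simp add: assoc_mult_mat[of _ N N _ N _ N])
  finally show ?case .
qed

lemma alt_prod_swap:
  fixes A B :: "'a::semiring_0 mat"
  assumes AB: "A \<in> carrier_mat N N" "B \<in> carrier_mat N N"
  shows "alt_prod B A k * A = B * alt_prod A B k"
proof (induction k)
  case (Suc k)
  have "alt_prod B A (Suc k) * A = B * (A * (alt_prod B A k * A))"
    using AB by (simp add: assoc_mult_mat[of _ N N _ N _ N])
  also have "\<dots> = B * alt_prod A B (Suc k)"
    unfolding Suc using AB by (simp add: assoc_mult_mat[of _ N N _ N _ N])
  finally show ?case .
qed simp

lemma alt_prod_bvec_0:
  "k \<le> n \<Longrightarrow> alt_prod (LK_X0 n) (LK_X1 n) k *\<^sub>v bvec n 0 = var_l \<cdot>\<^sub>v bvec n (2 * k)"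
proof (induction k)
  case (Suc k)
  then have "k < n" by simp
  have "alt_prod (LK_X0 n) (LK_X1 n) (Suc k) *\<^sub>v bvec n 0 =
      LK_X0 n *\<^sub>v (LK_X1 n *\<^sub>v (alt_prod (LK_X0 n) (LK_X1 n) k *\<^sub>v bvec n 0))"
    by (simp add: assoc_mult_mat_vec[of _ "Suc (2 * n)" "Suc (2 * n)" _ "Suc (2 * n)"])
  then show ?case
    using Suc by (simp add: LK_linear LK_X1_bvec_even LK_X0_bvec_odd)
qed (simp add: LK_X0_bvec_0)

text \<open>Write $P$ for the alternating product, $D$ for the Garside matrix and $C = X_1 X_0$. Both $P C =
  X_0 X_1 P$ and $D C = X_0 X_1 D$, so the subspace on which $P$ and $D$ agree is stable under $C$. It
  contains $v_0$. Up to the factor $l$ in the first and last step, $C$ maps $v_0 \mapsto v_1 \mapsto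
  v_3 \mapsto \dots \mapsto v_{2n-1} \mapsto v_{2n}$, and $C v_{2k+2}$ is $v_{2k}$ plus a combination of
  vectors that were reached before, so that the remaining even indices are obtained in descending order.\<close>

lemma alt_prod_eq_garside: "alt_prod (LK_X0 n) (LK_X1 n) n = garside n"
proof -
  define P where "P = alt_prod (LK_X0 n) (LK_X1 n) n"
  define K where "K = {w \<in> carrier_vec (Suc (2 * n)). P *\<^sub>v w = garside n *\<^sub>v w}"
  let ?C = "\<lambda>w. LK_X1 n *\<^sub>v (LK_X0 n *\<^sub>v w)"
  have P: "P \<in> carrier_mat (Suc (2 * n)) (Suc (2 * n))" by (simp add: P_def)
  note P_linear = mult_add_distrib_mat_vec[OF P] mult_minus_distrib_mat_vec[OF P] mult_mat_vec[OF P]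
  have add: "v + w \<in> K" and diff: "v - w \<in> K" if "v \<in> K" "w \<in> K" for v w
    using that by (auto simp: K_def P_linear garside_linear)
  have smult: "c \<cdot>\<^sub>v w \<in> K" if "w \<in> K" for c w
    using that by (auto simp: K_def P_linear garside_linear)
  have unscale: "w \<in> K" if "var_l \<cdot>\<^sub>v w \<in> K" for w
    using smult[OF that, of "1 / var_l"] var_l_nonzero by (simp add: smult_smult_assoc)
  have C: "?C w \<in> K" if w: "w \<in> K" for w
  proof -
    have wc: "w \<in> carrier_vec (Suc (2 * n))" using w by (simp add: K_def)
    have "P *\<^sub>v ?C w = (P * (LK_X1 n * LK_X0 n)) *\<^sub>v w"
      using wc P
      by (simp add: assoc_mult_mat_vec[of _ "Suc (2 * n)" "Suc (2 * n)" _ "Suc (2 * n)"] del: assoc_mult_mat)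
    also have "P * (LK_X1 n * LK_X0 n) = LK_X0 n * LK_X1 n * P"
      unfolding P_def by (rule alt_prod_shift[OF LK_X0_carrier LK_X1_carrier])
    also have "(LK_X0 n * LK_X1 n * P) *\<^sub>v w = LK_X0 n *\<^sub>v (LK_X1 n *\<^sub>v (P *\<^sub>v w))"
      using wc P mult_mat_vec_carrier[OF P wc]
      by (simp add: assoc_mult_mat_vec[of _ "Suc (2 * n)" "Suc (2 * n)" _ "Suc (2 * n)"] del: assoc_mult_mat)
    also have "\<dots> = garside n *\<^sub>v ?C w"
      using w wc by (simp add: K_def garside_LK_vec)
    finally show ?thesis by (simp add: K_def)
  qed
  have v0: "bvec n 0 \<in> K"
    by (simp add: K_def P_def alt_prod_bvec_0 garside_bvec_0)
  have odd: "bvec n (Suc (2 * k)) \<in> K" if "k < n" for k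
    using that
  proof (induction k)
    case 0
    have "?C (bvec n 0) = var_l \<cdot>\<^sub>v bvec n (Suc 0)"
      using 0 LK_X1_bvec_even[of 0 n] by (simp add: LK_X0_bvec_0 LK_linear)
    with C[OF v0] show ?case by (simp add: unscale)
  next
    case (Suc k)
    have "?C (bvec n (Suc (2 * k))) = bvec n (Suc (2 * Suc k))"
      using Suc.prems LK_X1_bvec_even[of "Suc k" n] by (simp add: LK_X0_bvec_odd)
    with C[of "bvec n (Suc (2 * k))"] Suc show ?case by simp
  qed
  have last: "bvec n (2 * n) \<in> K"
  proof (cases n)
    case 0
    with v0 show ?thesis by simp
  next
    case (Suc k)
    have "?C (bvec n (Suc (2 * k))) = var_l \<cdot>\<^sub>v bvec n (2 * n)"
      using LK_X0_bvec_odd[of k n] LK_X1_bvec_last[of n] Suc by simp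
    with C[OF odd[of k]] Suc show ?thesis by (simp add: unscale)
  qed
  have X1_even: "LK_X1 n *\<^sub>v bvec n (2 * k) \<in> K" if "k \<le> n" for k
    using that last odd[of k] smult[OF last]
    by (cases "k = n") (auto simp: LK_X1_bvec_last LK_X1_bvec_even)
  have even: "bvec n (2 * (n - i)) \<in> K" if "i \<le> n" for i
    using that
  proof (induction i)
    case (Suc i)
    \<comment> \<open>The image of $v_{2k+2}$ under $C$ is solved for its term $v_{2k}$. The image of $v_{2k+2}$ under
      $X_1$ is kept as it stands, since it has two forms: $v_{2k+3}$, or $l v_{2n}$ if $k + 1 = n$.\<close>
    define k where "k = n - Suc i"
    have k: "k < n" "n - i = Suc k" using Suc.prems by (auto simp: k_def)
    have IH: "bvec n (2 * Suc k) \<in> K" using Suc k by simp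
    have "?C (bvec n (2 * Suc k)) = var_m \<cdot>\<^sub>v (LK_X1 n *\<^sub>v bvec n (2 * 0))
        - var_m \<cdot>\<^sub>v (LK_X1 n *\<^sub>v bvec n (2 * Suc k)) + LK_X1 n *\<^sub>v bvec n (Suc (2 * k))"
      using k by (simp add: LK_X0_bvec_even LK_linear)
    moreover have "LK_X1 n *\<^sub>v bvec n (Suc (2 * k)) =
        bvec n (2 * k) - var_m \<cdot>\<^sub>v bvec n (Suc (2 * k)) + (var_m * var_l) \<cdot>\<^sub>v bvec n (2 * n)"
      using k by (simp add: LK_X1_bvec_odd)
    ultimately have "bvec n (2 * k) = ?C (bvec n (2 * Suc k))
        - var_m \<cdot>\<^sub>v (LK_X1 n *\<^sub>v bvec n (2 * 0)) + var_m \<cdot>\<^sub>v (LK_X1 n *\<^sub>v bvec n (2 * Suc k))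
        + var_m \<cdot>\<^sub>v bvec n (Suc (2 * k)) - (var_m * var_l) \<cdot>\<^sub>v bvec n (2 * n)"
      by (intro eq_vecI) (simp_all del: index_unit_vec(1) index_mult_mat_vec)
    also have "\<dots> \<in> K"
      using k by (intro add diff smult C IH X1_even odd last) auto
    finally show ?case by (simp add: k_def)
  qed (simp add: last)
  have "bvec n j \<in> K" if "j < Suc (2 * n)" for j
  proof -
    from that have "(\<exists>k\<le>n. j = 2 * k) \<or> (\<exists>k<n. j = Suc (2 * k))" by presburger
    moreover have "bvec n (2 * k) \<in> K" if "k \<le> n" for k
      using even[of "n - k"] that by simp
    ultimately show ?thesis using odd by blast
  qed
  then show ?thesis
    unfolding P_def[symmetric] by (intro mat_eq_on_basis[OF P garside_carrier]) (simp add: K_def)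
qed

lemma square_mat_unit:
  fixes A :: "'a::field mat"
  assumes A: "A \<in> carrier_mat N N"
    and inj: "\<And>w. w \<in> carrier_vec N \<Longrightarrow> A *\<^sub>v w = 0\<^sub>v N \<Longrightarrow> w = 0\<^sub>v N"
  shows "A \<in> Units (ring_mat TYPE('a) N b)"
proof (rule det_non_zero_imp_unit[OF A])
  show "det A \<noteq> 0"
    unfolding det_0_iff_vec_prod_zero_field[OF A] using inj by auto
qed

text \<open>The blocks of size two are invertible, which leaves only the coordinate $0$, where $X_0$
  multiplies by $l$.\<close>

lemma LK_X0_inj:
  assumes w: "w \<in> carrier_vec (Suc (2 * n))" and 0: "LK_X0 n *\<^sub>v w = 0\<^sub>v (Suc (2 * n))"
  shows "w = 0\<^sub>v (Suc (2 * n))"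
proof -
  have even: "w $ Suc (Suc (2 * k)) = 0" if "k < n" for k
    using LK_X0_mult_index_odd[OF w that] that 0 by simp
  have odd: "w $ Suc (2 * k) = 0" if "k < n" for k
    using LK_X0_mult_index_even[OF w that] that 0 even[OF that] by simp
  have pos: "w $ j = 0" if "j < Suc (2 * n)" "j \<noteq> 0" for j
    using that(1) by (cases rule: basis_index_cases) (use even odd that in auto)
  have "(\<Sum>j=1..2 * n. if even j then var_m * w $ j else 0) = 0"
    using pos by (intro sum.neutral) auto
  then have "w $ 0 = 0"
    using LK_X0_mult_index_first[OF w] 0 var_l_nonzero by simp
  with pos have "w $ j = 0" if "j < Suc (2 * n)" for j
    using that by (cases "j = 0") auto
  with w show ?thesis by (intro eq_vecI) auto
qed

text \<open>The Garside matrix is invertible, since its square is a nonzero scalar, and conjugation by it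
  turns $X_1$ into $X_0$.\<close>

lemma LK_X1_inj:
  assumes w: "w \<in> carrier_vec (Suc (2 * n))" and 0: "LK_X1 n *\<^sub>v w = 0\<^sub>v (Suc (2 * n))"
  shows "w = 0\<^sub>v (Suc (2 * n))"
proof -
  have "LK_X0 n *\<^sub>v (garside n *\<^sub>v w) = 0\<^sub>v (Suc (2 * n))"
    using garside_LK_vec(2)[OF w] 0 by (simp add: mat_mult_zero_vec)
  then have "garside n *\<^sub>v w = 0\<^sub>v (Suc (2 * n))" by (rule LK_X0_inj[rotated]) simp
  then have 0: "(var_l * var_l) \<cdot>\<^sub>v w = 0\<^sub>v (Suc (2 * n))"
    using garside_garside[OF w] by (simp only: mat_mult_zero_vec[OF garside_carrier])
  have "inverse (var_l * var_l) * (var_l * var_l) = 1"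
    using var_l_nonzero by (intro left_inverse) simp
  then have "w = (inverse (var_l * var_l) * (var_l * var_l)) \<cdot>\<^sub>v w"
    by (simp only: one_smult_vec)
  also have "\<dots> = 0\<^sub>v (Suc (2 * n))"
    by (simp only: smult_smult_assoc[of "inverse (var_l * var_l)" "var_l * var_l" w, symmetric]
      0 smult_vec_zero)
  finally show ?thesis .
qed

lemma LK_X0_unit: "LK_X0 n \<in> Units (ring_mat TYPE(F_Lambda) (Suc (2 * n)) b)"
  by (rule square_mat_unit[OF LK_X0_carrier], rule LK_X0_inj)

lemma LK_X1_unit: "LK_X1 n \<in> Units (ring_mat TYPE(F_Lambda) (Suc (2 * n)) b)"
  by (rule square_mat_unit[OF LK_X1_carrier], rule LK_X1_inj)

text \<open>If $Q$ is the product that begins with $X_1$, then $Q X_0 = X_1 P = X_1 D = D X_0$, and $X_0$ can be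
  cancelled.\<close>

lemma braid_relation: "alt_prod (LK_X0 n) (LK_X1 n) n = alt_prod (LK_X1 n) (LK_X0 n) n"
proof -
  let ?N = "Suc (2 * n)" and ?P = "alt_prod (LK_X1 n) (LK_X0 n) n"
  have "\<exists>Y\<in>carrier_mat ?N ?N. Y * LK_X0 n = 1\<^sub>m ?N \<and> LK_X0 n * Y = 1\<^sub>m ?N"
    using LK_X0_unit[of n "()"] by (simp only: Units_def ring_mat_simps mem_Collect_eq)
  then obtain Y where Y: "Y \<in> carrier_mat ?N ?N" "LK_X0 n * Y = 1\<^sub>m ?N" by blast
  have "?P * LK_X0 n = garside n * LK_X0 n"
    unfolding alt_prod_swap[OF LK_X0_carrier LK_X1_carrier] alt_prod_eq_garside garside_LK_X0 ..
  then have "?P * LK_X0 n * Y = garside n * LK_X0 n * Y" by (rule arg_cong)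
  then have "?P * (LK_X0 n * Y) = garside n * (LK_X0 n * Y)"
    using Y(1) by (simp only:
      assoc_mult_mat[OF alt_prod_carrier[OF LK_X1_carrier LK_X0_carrier] LK_X0_carrier]
      assoc_mult_mat[OF garside_carrier LK_X0_carrier])
  then show ?thesis
    unfolding Y(2) alt_prod_eq_garside
      right_mult_one_mat[OF alt_prod_carrier[OF LK_X1_carrier LK_X0_carrier]]
      right_mult_one_mat[OF garside_carrier] by (rule HOL.sym)
qed

section \<open>Invariant subspaces\<close>

text \<open>If it vanishes on a space that is stable under $X$, then $X$ satisfies the quadratic relation of
  a Hecke algebra there.\<close>

definition hecke_defect :: "'a::comm_ring_1 \<Rightarrow> 'a mat \<Rightarrow> 'a vec \<Rightarrow> 'a vec" where
  "hecke_defect m X w = X *\<^sub>v (X *\<^sub>v w) + m \<cdot>\<^sub>v (X *\<^sub>v w) - w"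

text \<open>On each block of size two, $X_0$ acts by a matrix with characteristic polynomial
  $x^2 + m x - 1$, so only the coordinate $0$ survives.\<close>

lemma hecke_defect_LK_X0:
  assumes w: "w \<in> carrier_vec (Suc (2 * n))"
  shows "\<exists>c. hecke_defect var_m (LK_X0 n) w = c \<cdot>\<^sub>v bvec n 0"
proof -
  let ?d = "hecke_defect var_m (LK_X0 n) w"
  note ix = LK_X0_mult_index_odd LK_X0_mult_index_even
  have "?d $ j = 0" if "j < Suc (2 * n)" "j \<noteq> 0" for j
    using that(1)
  proof (cases rule: basis_index_cases)
    case (odd k)
    then show ?thesis
      using w by (simp add: hecke_defect_def ix del: index_mult_mat_vec)
  next
    case (even k)
    then show ?thesis
      using w by (simp add: hecke_defect_def ix del: index_mult_mat_vec)
  qed (use that in simp)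
  then have "?d = (?d $ 0) \<cdot>\<^sub>v bvec n 0"
    using w by (intro eq_vecI) (auto simp: hecke_defect_def)
  then show ?thesis ..
qed

lemma hecke_defect_LK_X1:
  assumes w: "w \<in> carrier_vec (Suc (2 * n))"
  shows "\<exists>c. hecke_defect var_m (LK_X1 n) w = c \<cdot>\<^sub>v bvec n (2 * n)"
proof -
  let ?d = "hecke_defect var_m (LK_X1 n) w"
  note ix = LK_X1_mult_index_odd LK_X1_mult_index_even
  have "?d $ j = 0" if "j < Suc (2 * n)" "j \<noteq> 2 * n" for j
  proof -
    from that have "(\<exists>k<n. j = 2 * k) \<or> (\<exists>k<n. j = Suc (2 * k))" by presburger
    then consider k where "k < n" "j = 2 * k" | k where "k < n" "j = Suc (2 * k)" by blast
    then show ?thesis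
      using w by cases (simp_all add: hecke_defect_def ix del: index_mult_mat_vec)
  qed
  then have "?d = (?d $ (2 * n)) \<cdot>\<^sub>v bvec n (2 * n)"
    using w by (intro eq_vecI) (auto simp: hecke_defect_def)
  then show ?thesis ..
qed

text \<open>The only coordinate of $x = X_0 w$ that could have larger degree is $x_0$. The coordinate $0$
  of the relation $X_0 x + m x = w$ reads $(l + m) x_0 = w_0 - s$, where $s$ is a combination of the
  other coordinates of $x$ with coefficient $m$; dividing by $l + m$ lowers the degree.\<close>

lemma LK_X0_deg_nonpos:
  assumes w: "w \<in> carrier_vec (Suc (2 * n))"
    and hecke: "hecke_defect var_m (LK_X0 n) w = 0\<^sub>v (Suc (2 * n))"
    and deg: "\<And>j. j < Suc (2 * n) \<Longrightarrow> w $ j \<in> deg_nonpos"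
    and j: "j < Suc (2 * n)"
  shows "(LK_X0 n *\<^sub>v w) $ j \<in> deg_nonpos"
proof -
  let ?x = "LK_X0 n *\<^sub>v w"
  have pos: "?x $ j \<in> deg_nonpos" if "j < Suc (2 * n)" "j \<noteq> 0" for j
    using that(1)
  proof (cases rule: basis_index_cases)
    case (odd k)
    then show ?thesis
      using deg[of "Suc (Suc (2 * k))"] by (simp add: LK_X0_mult_index_odd[OF w] del: index_mult_mat_vec)
  next
    case (even k)
    then show ?thesis
      using deg by (simp add: LK_X0_mult_index_even[OF w] deg_nonpos_diff deg_nonpos_mult
          var_m_deg_nonpos del: index_mult_mat_vec)
  qed (use that in simp)
  define s where "s = (\<Sum>j=1..2 * n. if even j then var_m * ?x $ j else 0)"
  have s: "s \<in> deg_nonpos"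
    unfolding s_def
    by (rule deg_nonpos_sum)
      (use pos in \<open>auto simp: deg_nonpos_0 deg_nonpos_mult var_m_deg_nonpos
        simp del: index_mult_mat_vec\<close>)
  have "hecke_defect var_m (LK_X0 n) w $ 0 = (LK_X0 n *\<^sub>v ?x) $ 0 + var_m * ?x $ 0 - w $ 0"
    using w by (simp add: hecke_defect_def del: index_mult_mat_vec)
  then have "(var_l + var_m) * ?x $ 0 = w $ 0 - s"
    unfolding hecke LK_X0_mult_index_first[OF LK_mult_vec_carrier(1)] s_def[symmetric]
    by (simp add: algebra_simps del: index_mult_mat_vec)
  then have "?x $ 0 = 1 / (var_l + var_m) * (w $ 0 - s)"
    using var_l_plus_var_m_nonzero by (simp add: field_simps del: index_mult_mat_vec)
  also have "\<dots> \<in> deg_nonpos"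
    by (intro deg_nonpos_mult deg_nonpos_inverse_l_plus_m deg_nonpos_diff deg s) simp
  finally show ?thesis using pos j by (cases "j = 0") blast+
qed

text \<open>As for $X_0$, but the last coordinate of $X_1 x$ contains the odd coordinates of $x$ with
  coefficient $m l$. Division by $l + m$ compensates for the additional degree.\<close>

lemma LK_X1_deg_nonpos:
  assumes w: "w \<in> carrier_vec (Suc (2 * n))"
    and hecke: "hecke_defect var_m (LK_X1 n) w = 0\<^sub>v (Suc (2 * n))"
    and deg: "\<And>j. j < Suc (2 * n) \<Longrightarrow> w $ j \<in> deg_nonpos"
    and j: "j < Suc (2 * n)"
  shows "(LK_X1 n *\<^sub>v w) $ j \<in> deg_nonpos"
proof -
  let ?x = "LK_X1 n *\<^sub>v w"
  have pos: "?x $ j \<in> deg_nonpos" if "j < 2 * n" for j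
  proof -
    from that have "(\<exists>k<n. j = 2 * k) \<or> (\<exists>k<n. j = Suc (2 * k))" by presburger
    then consider k where "k < n" "j = 2 * k" | k where "k < n" "j = Suc (2 * k)" by blast
    then show ?thesis
      using deg by cases (simp_all add: LK_X1_mult_index_even[OF w] LK_X1_mult_index_odd[OF w]
          deg_nonpos_diff deg_nonpos_mult var_m_deg_nonpos del: index_mult_mat_vec)
  qed
  define s where "s = (\<Sum>j<2 * n. if odd j then var_m * ?x $ j else 0)"
  have s: "s \<in> deg_nonpos"
    unfolding s_def
    by (rule deg_nonpos_sum)
      (use pos in \<open>auto simp: deg_nonpos_0 deg_nonpos_mult var_m_deg_nonpos
        simp del: index_mult_mat_vec\<close>)
  have "(\<Sum>j<2 * n. if odd j then var_m * var_l * ?x $ j else 0) = var_l * s"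
    unfolding s_def sum_distrib_left by (rule sum.cong) (simp_all del: index_mult_mat_vec)
  moreover have "hecke_defect var_m (LK_X1 n) w $ (2 * n) =
      (LK_X1 n *\<^sub>v ?x) $ (2 * n) + var_m * ?x $ (2 * n) - w $ (2 * n)"
    using w by (simp add: hecke_defect_def del: index_mult_mat_vec)
  ultimately have "(var_l + var_m) * ?x $ (2 * n) = w $ (2 * n) - var_l * s"
    unfolding hecke LK_X1_mult_index_last[OF LK_mult_vec_carrier(2)]
    by (simp add: algebra_simps del: index_mult_mat_vec)
  then have "?x $ (2 * n) = (w $ (2 * n) - var_l * s) / (var_l + var_m)"
    unfolding nonzero_eq_divide_eq[OF var_l_plus_var_m_nonzero] by (subst mult.commute)
  also have "\<dots> = 1 / (var_l + var_m) * w $ (2 * n) - var_l / (var_l + var_m) * s"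
    by (simp add: diff_divide_distrib del: index_mult_mat_vec)
  also have "\<dots> \<in> deg_nonpos"
    by (intro deg_nonpos_mult deg_nonpos_inverse_l_plus_m deg_nonpos_l_over_l_plus_m
        deg_nonpos_diff deg s) simp
  finally show ?thesis using pos[of j] j by (cases "j = 2 * n") auto
qed

lemma alt_prod_invariant:
  assumes A: "A \<in> carrier_mat N N" and B: "B \<in> carrier_mat N N" and S: "S \<subseteq> carrier_vec N"
    and SA: "\<And>w. w \<in> S \<Longrightarrow> A *\<^sub>v w \<in> S" and SB: "\<And>w. w \<in> S \<Longrightarrow> B *\<^sub>v w \<in> S"
    and w: "w \<in> S"
  shows "alt_prod A B k *\<^sub>v w \<in> S"
proof (induction k)
  case (Suc k)
  have wc: "w \<in> carrier_vec N" using w S by blast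
  have "alt_prod A B (Suc k) *\<^sub>v w = A *\<^sub>v (B *\<^sub>v (alt_prod A B k *\<^sub>v w))"
    using A B wc by (simp add: assoc_mult_mat_vec[of _ N N _ N])
  with Suc SA SB show ?case by simp
qed (simp add: SA w)

lemma LK_invariant_subspace:
  assumes W: "W \<subseteq> carrier_vec (Suc (2 * n))"
    and zero: "0\<^sub>v (Suc (2 * n)) \<in> W"
    and add: "\<And>v w. v \<in> W \<Longrightarrow> w \<in> W \<Longrightarrow> v + w \<in> W"
    and smult: "\<And>c w. w \<in> W \<Longrightarrow> c \<cdot>\<^sub>v w \<in> W"
    and X0: "\<And>w. w \<in> W \<Longrightarrow> LK_X0 n *\<^sub>v w \<in> W"
    and X1: "\<And>w. w \<in> W \<Longrightarrow> LK_X1 n *\<^sub>v w \<in> W"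
  shows "W = {0\<^sub>v (Suc (2 * n))} \<or> W = carrier_vec (Suc (2 * n))"
proof -
  let ?N = "Suc (2 * n)"
  have garside: "garside n *\<^sub>v w \<in> S"
    if "S \<subseteq> carrier_vec ?N" "\<And>w. w \<in> S \<Longrightarrow> LK_X0 n *\<^sub>v w \<in> S" "\<And>w. w \<in> S \<Longrightarrow> LK_X1 n *\<^sub>v w \<in> S"
      "w \<in> S" for S w
    unfolding alt_prod_eq_garside[symmetric]
    by (rule alt_prod_invariant[OF LK_X0_carrier LK_X1_carrier]) (use that in auto)
  have unscale: "v \<in> W" if "c \<cdot>\<^sub>v v \<in> W" "c \<noteq> 0" for c v
    using smult[OF that(1), of "inverse c"] that(2) by (simp add: smult_smult_assoc)
  have defect: "hecke_defect var_m X w \<in> W" if "w \<in> W" "\<And>w. w \<in> W \<Longrightarrow> X *\<^sub>v w \<in> W" for X w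
  proof -
    have "hecke_defect var_m X w = X *\<^sub>v (X *\<^sub>v w) + var_m \<cdot>\<^sub>v (X *\<^sub>v w) + (- 1) \<cdot>\<^sub>v w"
      using that W by (intro eq_vecI) (auto simp: hecke_defect_def simp del: index_mult_mat_vec)
    with that add smult show ?thesis by simp
  qed
  have full: "W = carrier_vec ?N" if "bvec n 0 \<in> W"
    using unit_vecs_span[OF zero add smult LK_cyclic[OF that X0 X1]] W by blast
  show ?thesis
  proof (cases "\<forall>w\<in>W. hecke_defect var_m (LK_X0 n) w = 0\<^sub>v ?N \<and>
      hecke_defect var_m (LK_X1 n) w = 0\<^sub>v ?N")
    case False
    have "bvec n 0 \<in> W"
    proof (cases "\<exists>w\<in>W. hecke_defect var_m (LK_X0 n) w \<noteq> 0\<^sub>v ?N")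
      case True
      then obtain w where w: "w \<in> W" "hecke_defect var_m (LK_X0 n) w \<noteq> 0\<^sub>v ?N" by blast
      obtain c where c: "hecke_defect var_m (LK_X0 n) w = c \<cdot>\<^sub>v bvec n 0"
        using hecke_defect_LK_X0 w W by blast
      with w have "c \<noteq> 0" by auto
      with defect[OF w(1) X0] c show ?thesis by (simp add: unscale)
    next
      case no: False
      with False obtain w where w: "w \<in> W" "hecke_defect var_m (LK_X1 n) w \<noteq> 0\<^sub>v ?N" by blast
      obtain c where c: "hecke_defect var_m (LK_X1 n) w = c \<cdot>\<^sub>v bvec n (2 * n)"
        using hecke_defect_LK_X1 w W by blast
      with w have "c \<noteq> 0" by auto
      with defect[OF w(1) X1] c have "bvec n (2 * n) \<in> W" by (simp add: unscale)
      then have "garside n *\<^sub>v bvec n (2 * n) \<in> W" by (rule garside[OF W X0 X1, rotated -1])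
      then show ?thesis
        unfolding garside_bvec_last by (rule unscale) (rule var_l_nonzero)
    qed
    then show ?thesis using full by blast
  next
    case True
    \<comment> \<open>\<open>W\<close> is a module over the Hecke algebra, and degrees in $l$ show that it is zero.\<close>
    have "w = 0\<^sub>v ?N" if w: "w \<in> W" for w
    proof (rule ccontr)
      assume "w \<noteq> 0\<^sub>v ?N"
      then obtain s where "s < ?N" "w $ s \<noteq> 0"
        using W w by (metis carrier_vecD eq_vecI index_zero_vec subsetD)
      then obtain i where i: "i < ?N" "w $ i \<noteq> 0" "\<forall>j\<in>{..<?N}. w $ j / w $ i \<in> deg_nonpos"
        using max_degree_index[of "{..<?N}" s "\<lambda>j. w $ j"] by auto
      \<comment> \<open>Rescaling makes the vector integral with a coordinate equal to $1$, so that the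
        coordinate of its $l^2$-fold is not integral.\<close>
      define w' where "w' = inverse (w $ i) \<cdot>\<^sub>v w"
      define S where "S = {w \<in> W. \<forall>j<?N. w $ j \<in> deg_nonpos}"
      have S: "S \<subseteq> carrier_vec ?N" using W by (auto simp: S_def)
      have w': "w' \<in> S" "w' $ i = 1"
        using i W w smult by (auto simp: w'_def S_def field_simps)
      have "garside n *\<^sub>v v \<in> S" if "v \<in> S" for v
      proof (rule garside[OF S _ _ that])
        fix w assume "w \<in> S"
        then show "LK_X0 n *\<^sub>v w \<in> S" "LK_X1 n *\<^sub>v w \<in> S"
          using True X0 X1 W LK_X0_deg_nonpos[of w n] LK_X1_deg_nonpos[of w n]
          by (auto simp: S_def simp del: index_mult_mat_vec)
      qed
      with w' have "garside n *\<^sub>v (garside n *\<^sub>v w') \<in> S" by blast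
      then have "(var_l * var_l) \<cdot>\<^sub>v w' \<in> S" using garside_garside[of w' n] w' S by auto
      then have "((var_l * var_l) \<cdot>\<^sub>v w') $ i \<in> deg_nonpos" using i by (simp add: S_def)
      moreover have "((var_l * var_l) \<cdot>\<^sub>v w') $ i = var_l * var_l"
        using w' S i by auto
      ultimately show False using var_l_sq_not_deg_nonpos by simp
    qed
    with zero show ?thesis by blast
  qed
qed

section \<open>The representation and its irreducibility\<close>

lemma GL_mat_simps: "monoid.mult (GL_mat TYPE('a::field) N) = (*)" "one (GL_mat TYPE('a) N) = 1\<^sub>m N"
  "carrier (GL_mat TYPE('a) N) = Units (ring_mat TYPE('a) N ())"
  by (simp_all add: GL_mat_def units_of_def ring_mat_simps)

lemma group_GL_mat: "group (GL_mat TYPE('a::field) N)"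
proof -
  interpret ring "ring_mat TYPE('a) N ()" by (rule ring_mat)
  show ?thesis unfolding GL_mat_def by (rule units_group)
qed

lemma word_value_alt_word:
  assumes "\<And>x. f x \<in> carrier_mat N N"
  shows "word_value (GL_mat TYPE('a::field) N) f (alt_word x y (2 * k + 1)) = alt_prod (f x) (f y) k"
  using assms by (induction k) (simp_all add: GL_mat_simps right_mult_one_mat[of _ N N])

lemma LK_representation_exists: "\<exists>\<rho>. is_LK_rep n \<rho>"
proof -
  let ?N = "2 * n + 1"
  let ?G = "GL_mat TYPE(F_Lambda) ?N"
  interpret G: group ?G by (rule group_GL_mat)
  define f where "f s = (case s of Sigma0 \<Rightarrow> LK_X0 n | Sigma1 \<Rightarrow> LK_X1 n)" for s
  have fc: "f s \<in> carrier_mat ?N ?N" for s by (simp add: f_def split: artin_gen.split)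
  have f: "f s \<in> carrier ?G" for s
    by (simp add: f_def GL_mat_simps LK_X0_unit LK_X1_unit split: artin_gen.split)
  have braid: "word_value ?G f (alt_word Sigma0 Sigma1 ?N) = word_value ?G f (alt_word Sigma1 Sigma0 ?N)"
    unfolding word_value_alt_word[of f ?N Sigma0 Sigma1 n, OF fc]
      word_value_alt_word[of f ?N Sigma1 Sigma0 n, OF fc]
    unfolding f_def artin_gen.case by (rule braid_relation)
  have rel: "word_value ?G f u = word_value ?G f v" if "(u, v) \<in> artin_relations ?N" for u v
  proof -
    from that have "u = alt_word Sigma0 Sigma1 ?N" "v = alt_word Sigma1 Sigma0 ?N"
      unfolding artin_relations_def singleton_iff prod.inject by blast+
    then show ?thesis using braid by (simp only:)
  qed
  obtain h where h: "group_hom (presented_group (artin_relations ?N)) ?G h"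
    "\<And>u. h (pres_class (artin_relations ?N) u) = word_value ?G f u"
    using G.presented_group_universal[OF f rel] by blast
  have "h (artin_sigma ?N s) = f s" for s
    using fc[of s] by (simp add: artin_sigma_def h(2)[simplified] GL_mat_simps)
  with h(1) have "is_LK_rep n h"
    by (simp add: is_LK_rep_def representation_def artin_I2_def f_def)
  then show ?thesis by (rule exI[of _ h])
qed

theorem theorem3p3:
  fixes n :: nat
  assumes "n \<ge> 1"
  shows "(\<exists>\<rho>. is_LK_rep n \<rho>) \<and>
    (\<forall>\<rho>. is_LK_rep n \<rho> \<longrightarrow> irreducible_rep (artin_I2 (2 * n + 1)) (2 * n + 1) \<rho>)"
proof (intro conjI allI impI LK_representation_exists)
  fix \<rho> assume \<rho>: "is_LK_rep n \<rho>"
  let ?N = "2 * n + 1"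
  have \<sigma>: "artin_sigma ?N s \<in> carrier (artin_I2 ?N)" for s
    by (simp add: artin_sigma_def artin_I2_def presented_group_def)
  have "bvec n 0 \<noteq> 0\<^sub>v (Suc (2 * n))" by simp
  then have "carrier_vec ?N \<noteq> {0\<^sub>v ?N :: F_Lambda vec}"
    using unit_vec_carrier[of ?N 0] by (metis Suc_eq_plus1 singletonD)
  moreover have "W = {0\<^sub>v ?N} \<or> W = carrier_vec ?N"
    if sub: "VectorSpace.subspace class_ring W (module_vec TYPE(F_Lambda) ?N)"
      and inv: "\<forall>g\<in>carrier (artin_I2 ?N). \<forall>w\<in>W. \<rho> g *\<^sub>v w \<in> W" for W
  proof -
    interpret submodule class_ring W "module_vec TYPE(F_Lambda) ?N"
      using sub by (simp add: subspace_def)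
    have X: "LK_X0 n *\<^sub>v w \<in> W" "LK_X1 n *\<^sub>v w \<in> W" if "w \<in> W" for w
      using inv \<sigma> that \<rho> unfolding is_LK_rep_def by metis+
    show ?thesis
      using LK_invariant_subspace[of W n] subset m_closed zero_closed smult_closed X
      by (simp add: module_vec_simps)
  qed
  ultimately show "irreducible_rep (artin_I2 ?N) ?N \<rho>"
    using \<rho> by (simp add: irreducible_rep_def is_LK_rep_def)
qed

end
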